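(* Let $C=\{x\in\mathbb{R}:\mu(\{x\})+\pi_{X=x}(D)=0\}$ and, for $\varepsilon>0$, let $D_\varepsilon=\{y\in\mathcal{Y}:\pi_{Y=y}((x_\varepsilon,x_\varepsilon+\varepsilon])=1\text{ for some }x_\varepsilon\in\mathbb{R}\}$. Assume that there exist $\varepsilon>0$, a diffuse probability measure $\eta$ on $\mathbb{R}$, and a subset $\mathcal{X}$ of $\mathbb{R}$ with at most countable closure, such that for $\nu$-almost every $y$ in the set $\{y\in D_\varepsilon\cap D^c:\pi_{Y=y}(C)=1\}$ at least one of the following holds: (i) the cumulative distribution function $F_{Y=y}$ of $\pi_{Y=y}$ is strictly increasing on some interval of positive length; (ii) there exists a probability measure $\gamma_y$ on $\mathbb{R}$ such that $\gamma_y\ll\pi_{Y=y}$ and $\gamma_y\ll\eta$; (iii) there exists $x\in\mathcal{X}$ such that $F_{Y=y}(x)\in(0,1)$. Then condition $(\mathcal{D})$ holds if and only if property $(\mathcal{R}_+)$ holds.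
   Context: Setting: $\mathcal{Y}$ is a separable Banach space with Borel $\sigma$-algebra $\mathcal{B}(\mathcal{Y})$, and $\pi$ is a probability measure on $\mathbb{R}\times\mathcal{Y}$ (with its Borel $\sigma$-algebra) with first marginal $\mu$ on $\mathbb{R}$ and second marginal $\nu$ on $\mathcal{Y}$. Fix probability kernels $(\pi_{X=x})_{x\in\mathbb{R}}$ (probability measures on $\mathcal{Y}$) and $(\pi_{Y=y})_{y\in\mathcal{Y}}$ (probability measures on $\mathbb{R}$) disintegrating $\pi$: $\pi(dx,dy)=\mu(dx)\,\pi_{X=x}(dy)=\nu(dy)\,\pi_{Y=y}(dx)$. $D$ is the Borel set $D=\{y\in\mathcal{Y}:\pi_{Y=y}\text{ is a Dirac mass}\}$, and $D^c$ is its complement in $\mathcal{Y}$. $L^1_+(\mu)$ denotes the set of non-negative elements of $L^1(\mu)$. A probability measure is diffuse if it has no atoms. Condition $(\mathcal{D})$: $\pi_{X=x}(D)>0$ for $\mu$-a.e. $x$. Property $(\mathcal{R}_+)$: for every $f\in L^1_+(\mu)$ there exists a measurable $g:\mathcal{Y}\to\mathbb{R}_+=[0,\infty)$ such that $f(x)=\int_{\mathcal{Y}}g(y)\,\pi_{X=x}(dy)$ for $\mu$-a.e. $x$. *)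

theory Defs
  imports "HOL-Probability.Probability"
begin

abbreviation marg_fst :: "('a::topological_space \<times> 'b::topological_space) measure \<Rightarrow> 'a measure" where
  "marg_fst \<pi> \<equiv> distr \<pi> borel fst"

abbreviation marg_snd :: "('a::topological_space \<times> 'b::topological_space) measure \<Rightarrow> 'b measure" where
  "marg_snd \<pi> \<equiv> distr \<pi> borel snd"

definition disintegration_fst ::
  "('a::topological_space \<times> 'b::topological_space) measure \<Rightarrow> ('a \<Rightarrow> 'b measure) \<Rightarrow> bool" where
  "disintegration_fst \<pi> K \<longleftrightarrow>
     K \<in> borel \<rightarrow>\<^sub>M prob_algebra borel \<and>
     (\<forall>E\<in>sets \<pi>. emeasure \<pi> E = (\<integral>\<^sup>+x. emeasure (K x) {y. (x, y) \<in> E} \<partial>marg_fst \<pi>))"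

definition disintegration_snd ::
  "('a::topological_space \<times> 'b::topological_space) measure \<Rightarrow> ('b \<Rightarrow> 'a measure) \<Rightarrow> bool" where
  "disintegration_snd \<pi> K \<longleftrightarrow>
     K \<in> borel \<rightarrow>\<^sub>M prob_algebra borel \<and>
     (\<forall>E\<in>sets \<pi>. emeasure \<pi> E = (\<integral>\<^sup>+y. emeasure (K y) {x. (x, y) \<in> E} \<partial>marg_snd \<pi>))"

definition diffuse :: "real measure \<Rightarrow> bool" where
  "diffuse \<eta> \<longleftrightarrow> (\<forall>x. measure \<eta> {x} = 0)"

definition dirac_set :: "('y \<Rightarrow> real measure) \<Rightarrow> 'y set" where
  "dirac_set KY = {y. \<exists>x. KY y = return borel x}"

definition eps_set :: "('y \<Rightarrow> real measure) \<Rightarrow> real \<Rightarrow> 'y set" where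
  "eps_set KY \<epsilon> = {y. \<exists>x. measure (KY y) {x<..x + \<epsilon>} = 1}"

definition C_set ::
  "(real \<times> 'y::topological_space) measure \<Rightarrow> (real \<Rightarrow> 'y measure) \<Rightarrow> ('y \<Rightarrow> real measure) \<Rightarrow> real set" where
  "C_set \<pi> KX KY = {x. measure (marg_fst \<pi>) {x} + measure (KX x) (dirac_set KY) = 0}"

definition cond_D ::
  "(real \<times> 'y::topological_space) measure \<Rightarrow> (real \<Rightarrow> 'y measure) \<Rightarrow> ('y \<Rightarrow> real measure) \<Rightarrow> bool" where
  "cond_D \<pi> KX KY \<longleftrightarrow> (AE x in marg_fst \<pi>. measure (KX x) (dirac_set KY) > 0)"

text \<open>The representation is stated with the nonnegative integral, because the Bochner integral of
  a nonintegrable \<open>g\<close> is \<open>0\<close> by convention. Elements of \<open>L\<^sup>1\<^sub>+(\<mu>)\<close> are given by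
  integrable representatives that are nonnegative almost everywhere.\<close>

definition prop_Rplus ::
  "(real \<times> 'y::topological_space) measure \<Rightarrow> (real \<Rightarrow> 'y measure) \<Rightarrow> bool" where
  "prop_Rplus \<pi> KX \<longleftrightarrow>
     (\<forall>f::real \<Rightarrow> real. integrable (marg_fst \<pi>) f \<and> (AE x in marg_fst \<pi>. 0 \<le> f x) \<longrightarrow>
        (\<exists>g::'y \<Rightarrow> real. g \<in> borel_measurable borel \<and> (\<forall>y. 0 \<le> g y) \<and>
           (AE x in marg_fst \<pi>. ennreal (f x) = (\<integral>\<^sup>+y. ennreal (g y) \<partial>KX x))))"

end

theory Submission
  imports Defs
begin

text \<open>
  If \<open>\<pi>\<^bsub>Y=y\<^esub>\<close> is the Dirac mass at \<open>\<phi>(y)\<close> for \<open>y \<in> D\<close>, then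
  \<open>g(y) = f(\<phi>(y)) / \<pi>\<^bsub>X=\<phi>(y)\<^esub>(D)\<close> on \<open>D\<close>, and \<open>0\<close> elsewhere, represents \<open>f\<close>
  under condition (D).

  Conversely, representing the indicator of a Borel set \<open>A\<close> gives a set \<open>B\<close> such that
  \<open>\<pi>\<^bsub>Y=y\<^esub>(A) = 1\<close> for almost all \<open>y \<in> B\<close> and \<open>\<pi>\<^bsub>X=x\<^esub>(B) > 0\<close> for almost all \<open>x \<in> A\<close>. With
  \<open>A = {x}\<close> this settles the atoms of \<open>\<mu>\<close>, so it remains to see that \<open>\<mu>(C) = 0\<close>. The complement of
  the closure of \<open>X\<close> is covered by countably many rational intervals \<open>(q, r)\<close> of length at most
  \<open>\<epsilon>\<close> that avoid \<open>X\<close>. A kernel measure concentrated on \<open>C \<inter> (q, r)\<close> cannot satisfy (iii);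
  under (i) or (ii) the number of cells of the grid of mesh \<open>1/k\<close> that it charges tends to infinity.
  A random union of grid cells, each chosen with small probability, has small \<open>\<mu>\<close>-mass but is charged
  by almost all such measures. Removing from \<open>C \<inter> (q, r)\<close> a countable union of such sets leaves a set
  \<open>A\<close> that almost no \<open>\<pi>\<^bsub>Y=y\<^esub>\<close> with \<open>y \<notin> D\<close> is concentrated on, hence \<open>\<mu>(A) = 0\<close>.
\<close>

subsection \<open>Hitting measures that charge many grid cells\<close>

text \<open>The right-hand side is the expectation of the left-hand side for a random \<open>T\<close> that contains
  each element of \<open>J\<close> independently with probability \<open>p\<close>; the induction decides element by element.\<close>

lemma exists_hitting_subset:
  fixes w :: "'a \<Rightarrow> real" and v :: "'a set \<Rightarrow> real"
  assumes "finite J" and p: "0 \<le> p" "p \<le> 1"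
  shows "\<exists>T\<subseteq>J. (\<Sum>j\<in>T. w j) + (\<Sum>S\<in>Pow J. if S \<inter> T = {} then v S else 0)
           \<le> p * (\<Sum>j\<in>J. w j) + (\<Sum>S\<in>Pow J. (1 - p) ^ card S * v S)"
  using \<open>finite J\<close>
proof (induction J arbitrary: v rule: finite_induct)
  case empty
  then show ?case by simp
next
  case (insert a J)
  have split: "(\<Sum>S\<in>Pow (insert a J). h S) = (\<Sum>S\<in>Pow J. h S + h (insert a S))"
    for h :: "'a set \<Rightarrow> real"
  proof -
    have "inj_on (insert a) (Pow J)"
      using insert.hyps(2) by (auto simp: inj_on_def)
    moreover have "Pow J \<inter> insert a ` Pow J = {}"
      using insert.hyps(2) by auto
    ultimately show ?thesis
      using insert.hyps(1) by (simp add: Pow_insert sum.union_disjoint sum.reindex sum.distrib)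
  qed
  define cost where "cost u T = (\<Sum>j\<in>T. w j) + (\<Sum>S\<in>Pow J. if S \<inter> T = {} then u S else 0)"
    for u :: "'a set \<Rightarrow> real" and T
  define bound where "bound u = p * (\<Sum>j\<in>J. w j) + (\<Sum>S\<in>Pow J. (1 - p) ^ card S * u S)"
    for u :: "'a set \<Rightarrow> real"
  \<comment> \<open>If \<open>a\<close> is left out of \<open>T\<close>, then \<open>S\<close> and
    \<open>insert a S\<close> are hit or missed together, so their weights merge; if
    \<open>a\<close> is chosen, only the sets without \<open>a\<close> still count.\<close>
  define v' where "v' S = v S + v (insert a S)" for S
  obtain T1 where T1: "T1 \<subseteq> J" "cost v T1 \<le> bound v"
    using insert.IH[of v] unfolding cost_def bound_def by blast
  obtain T2 where T2: "T2 \<subseteq> J" "cost v' T2 \<le> bound v'"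
    using insert.IH[of v'] unfolding cost_def bound_def by blast
  let ?cost = "\<lambda>T. (\<Sum>j\<in>T. w j) + (\<Sum>S\<in>Pow (insert a J). if S \<inter> T = {} then v S else 0)"
  let ?bound = "p * (\<Sum>j\<in>insert a J. w j) + (\<Sum>S\<in>Pow (insert a J). (1 - p) ^ card S * v S)"
  have "a \<notin> T1" "finite T1"
    using T1(1) insert.hyps finite_subset by auto
  moreover have "(\<Sum>S\<in>Pow J. if S \<inter> insert a T1 = {} then v S else 0) =
      (\<Sum>S\<in>Pow J. if S \<inter> T1 = {} then v S else 0)"
    using insert.hyps(2) by (intro sum.cong) auto
  ultimately have cost1: "?cost (insert a T1) = w a + cost v T1"
    by (simp add: split cost_def)
  have "a \<notin> T2"
    using T2(1) insert.hyps by auto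
  then have cost2: "?cost T2 = cost v' T2"
    by (auto simp: split cost_def v'_def intro!: sum.cong)
  have "(\<Sum>S\<in>Pow J. (1 - p) ^ card S * v S + (1 - p) ^ card (insert a S) * v (insert a S)) =
     (\<Sum>S\<in>Pow J. p * ((1 - p) ^ card S * v S) + (1 - p) * ((1 - p) ^ card S * v' S))"
  proof (rule sum.cong)
    fix S assume "S \<in> Pow J"
    then have "card (insert a S) = Suc (card S)"
      using insert.hyps by (metis PowD card_insert_disjoint finite_subset subsetD)
    then show "(1 - p) ^ card S * v S + (1 - p) ^ card (insert a S) * v (insert a S) =
      p * ((1 - p) ^ card S * v S) + (1 - p) * ((1 - p) ^ card S * v' S)"
      by (simp add: v'_def algebra_simps)
  qed simp
  also have "\<dots> = p * (\<Sum>S\<in>Pow J. (1 - p) ^ card S * v S) + (1 - p) * (\<Sum>S\<in>Pow J. (1 - p) ^ card S * v' S)"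
    by (simp only: sum.distrib sum_distrib_left)
  finally have "(\<Sum>S\<in>Pow (insert a J). (1 - p) ^ card S * v S) = \<dots>"
    by (simp only: split)
  then have bnd: "?bound = p * (w a + bound v) + (1 - p) * bound v'"
    using insert.hyps by (simp add: bound_def algebra_simps)
  \<comment> \<open>The bound is the average of the two alternatives with weights \<open>p\<close>
    and \<open>1 - p\<close>, so one of them does not exceed it.\<close>
  have "w a + bound v \<le> ?bound \<or> bound v' \<le> ?bound"
  proof (rule ccontr)
    assume *: "\<not> ?thesis"
    have "p * (?bound - (w a + bound v)) + (1 - p) * (?bound - bound v') = 0"
      using bnd by (simp only: algebra_simps)
    moreover have "p * (?bound - (w a + bound v)) \<le> 0" "(1 - p) * (?bound - bound v') \<le> 0"
      using * p by (auto intro!: mult_nonneg_nonpos)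
    ultimately have "p * (?bound - (w a + bound v)) = 0" "(1 - p) * (?bound - bound v') = 0"
      by linarith+
    then show False using * by (auto simp del: split)
  qed
  then show ?case
  proof
    assume "w a + bound v \<le> ?bound"
    then have "?cost (insert a T1) \<le> ?bound"
      using cost1 T1(2) by linarith
    then show ?thesis using T1(1) by blast
  next
    assume "bound v' \<le> ?bound"
    then have "?cost T2 \<le> ?bound"
      using cost2 T2(2) by linarith
    then show ?thesis using T2(1) by blast
  qed
qed

text \<open>For \<open>k > 0\<close> the cell is the interval \<open>((j - 1) / k, j / k]\<close>; the case \<open>k = 0\<close> is
  degenerate and harmless, since only \<open>k \<rightarrow> \<infinity>\<close> matters.\<close>

definition cell :: "nat \<Rightarrow> int \<Rightarrow> real set" where
  "cell k j = {x. \<lceil>real k * x\<rceil> = j}"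

text \<open>For \<open>k > 0\<close> these cells fill \<open>(-k - 1/k, k]\<close>: a finite family
  whose window exhausts the line while its mesh shrinks.\<close>

definition grid :: "nat \<Rightarrow> int set" where
  "grid k = {- (int k ^ 2)..int k ^ 2}"

definition charged :: "real measure \<Rightarrow> nat \<Rightarrow> int set" where
  "charged \<kappa> k = {j \<in> grid k. measure \<kappa> (cell k j) \<noteq> 0}"

text \<open>Asking this for all large \<open>k\<close>, not just infinitely many, lets one mesh
  serve all \<open>y\<close> outside a set of small measure.\<close>

definition spread :: "real measure \<Rightarrow> bool" where
  "spread \<kappa> \<longleftrightarrow> (\<forall>s. \<forall>\<^sub>F k in sequentially. s \<le> card (charged \<kappa> k))"

lemma sets_cell [measurable]: "cell k j \<in> sets borel"
  unfolding cell_def by measurable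

lemma cell_eq: "cell (Suc k) j = {(real_of_int j - 1) / Suc k<..real_of_int j / Suc k}"
  by (auto simp: cell_def ceiling_eq_iff field_simps)

lemma disjoint_cell: "disjoint_family_on (cell k) J"
  by (auto simp: disjoint_family_on_def cell_def)

lemma finite_grid [simp]: "finite (grid k)"
  by (simp add: grid_def)

lemma charged_subset: "charged \<kappa> k \<subseteq> grid k"
  by (auto simp: charged_def)

lemma measurable_charged:
  assumes K[measurable]: "K \<in> N \<rightarrow>\<^sub>M prob_algebra borel"
  shows "Measurable.pred N (\<lambda>y. charged (K y) k = S)"
    and "(\<lambda>y. card (charged (K y) k)) \<in> N \<rightarrow>\<^sub>M count_space UNIV"
proof -
  have K'[measurable]: "K \<in> N \<rightarrow>\<^sub>M subprob_algebra borel"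
    using K by (rule measurable_prob_algebraD)
  have [measurable]: "(\<lambda>y. measure (K y) A) \<in> borel_measurable N" if "A \<in> sets borel" for A
    using that by measurable
  have *: "Measurable.pred N (\<lambda>y. charged (K y) k = S)" for S
  proof -
    have "(charged (K y) k = S) \<longleftrightarrow>
        (\<forall>j\<in>grid k. (measure (K y) (cell k j) \<noteq> 0) = (j \<in> S)) \<and> S \<subseteq> grid k" for y
      by (auto simp: charged_def)
    then show ?thesis
      by (simp only:) measurable
  qed
  then show "Measurable.pred N (\<lambda>y. charged (K y) k = S)" .
  have "(\<lambda>y. charged (K y) k) \<in> N \<rightarrow>\<^sub>M count_space (Pow (grid k))"
    using * by (subst measurable_count_space_eq2) (auto simp: charged_def pred_def vimage_def Int_def conj_commute)
  then show "(\<lambda>y. card (charged (K y) k)) \<in> N \<rightarrow>\<^sub>M count_space UNIV"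
    by (rule measurable_compose) simp
qed

lemma measurable_spread:
  assumes [measurable]: "K \<in> N \<rightarrow>\<^sub>M prob_algebra borel"
  shows "Measurable.pred N (\<lambda>y. spread (K y))"
proof -
  note measurable_charged(2)[measurable]
  show ?thesis
    unfolding spread_def eventually_sequentially by measurable
qed

text \<open>Choosing each cell of a fine grid independently with probability \<open>p\<close>, the union has expected
  \<open>M\<close>-mass at most \<open>p\<close> times the total, whereas a measure charging \<open>s\<close> cells misses it with
  probability at most \<open>(1 - p)^s\<close>.\<close>

lemma spread_removal:
  fixes K :: "'b \<Rightarrow> real measure"
  assumes "finite_measure N" and K[measurable]: "K \<in> N \<rightarrow>\<^sub>M prob_algebra borel"
    and "finite_measure M" and sM[measurable_cong]: "sets M = sets borel" and "0 < \<rho>"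
  obtains R where "R \<in> sets borel" "measure M R \<le> \<rho>"
    "measure N {y \<in> space N. spread (K y) \<and> measure (K y) R = 0} \<le> \<rho>"
proof -
  interpret N: finite_measure N by fact
  interpret M: finite_measure M by fact
  note measurable_charged[measurable] measurable_spread[measurable]
  have K'[measurable]: "K \<in> N \<rightarrow>\<^sub>M subprob_algebra borel"
    using K by (rule measurable_prob_algebraD)
  have "\<exists>p. 0 < p \<and> p < 1 \<and> p * c \<le> \<rho> / 3" if "0 \<le> c" for c :: real
  proof (intro exI conjI)
    \<comment> \<open>Dividing by \<open>c + 1\<close> covers \<open>c = 0\<close>, where a quotient
      by \<open>c\<close> would be 0.\<close>
    let ?p = "min (1/2) (\<rho> / (3 * (c + 1)))"
    show "0 < ?p" "?p < 1" using that \<open>0 < \<rho>\<close> by auto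
    have "?p * c \<le> \<rho> / (3 * (c + 1)) * (c + 1)"
      using that \<open>0 < \<rho>\<close> by (intro mult_mono) auto
    also have "\<dots> = \<rho> / 3" using that by (simp add: field_simps)
    finally show "?p * c \<le> \<rho> / 3" .
  qed
  then obtain p where p: "0 < p" "p < 1" "p * measure M UNIV \<le> \<rho> / 3"
    using measure_nonneg by blast
  have "(\<lambda>s. (1 - p) ^ s * measure N (space N)) \<longlonglongrightarrow> 0 * measure N (space N)"
    using p by (intro tendsto_intros LIMSEQ_realpow_zero) auto
  then have "\<forall>\<^sub>F s in sequentially. (1 - p) ^ s * measure N (space N) < \<rho> / 3"
    using \<open>0 < \<rho>\<close> by (intro order_tendstoD) auto
  then obtain s where s: "(1 - p) ^ s * measure N (space N) < \<rho> / 3"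
    by (auto simp: eventually_sequentially)
  \<comment> \<open>Here the bound \<open>s\<close> still fails at or beyond mesh \<open>k\<close>.
    By \<open>spread\<close> these sets decrease to the empty set, so a fixed \<open>k\<close> makes
    the failure small.\<close>
  define H where "H k = {y \<in> space N. spread (K y) \<and> (\<exists>i\<ge>k. card (charged (K y) i) < s)}" for k
  have H_sets [measurable]: "H k \<in> sets N" for k
    unfolding H_def by measurable
  have "decseq H"
    by (auto simp: decseq_def H_def) (meson order_trans)
  moreover have "(\<Inter>k. H k) = {}"
  proof -
    have False if "y \<in> (\<Inter>k. H k)" for y
    proof -
      have "\<forall>\<^sub>F k in sequentially. s \<le> card (charged (K y) k)"
        using that by (auto simp: H_def spread_def)
      then obtain k where "\<And>i. i \<ge> k \<Longrightarrow> s \<le> card (charged (K y) i)"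
        by (auto simp: eventually_sequentially)
      with that show False by (auto simp: H_def not_less[symmetric])
    qed
    then show ?thesis by blast
  qed
  ultimately have "(\<lambda>k. measure N (H k)) \<longlonglongrightarrow> 0"
    using N.finite_Lim_measure_decseq[of H] by (simp add: image_subset_iff H_sets)
  then have "\<forall>\<^sub>F k in sequentially. measure N (H k) < \<rho> / 3"
    using \<open>0 < \<rho>\<close> by (intro order_tendstoD) auto
  then obtain k where k: "measure N (H k) < \<rho> / 3"
    by (auto simp: eventually_sequentially)
  \<comment> \<open>The weights for the random choice: \<open>y\<close> is sorted by its pattern of
    charged cells, provided that this pattern has at least \<open>s\<close> cells.\<close>
  define V where "V S = {y \<in> space N. s \<le> card (charged (K y) k) \<and> charged (K y) k = S}" for S
  have V_sets [measurable]: "V S \<in> sets N" for S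
    unfolding V_def by measurable
  have sum_V: "(\<Sum>S\<in>\<S>. measure N (V S)) = measure N (\<Union>S\<in>\<S>. V S)" if "\<S> \<subseteq> Pow (grid k)" for \<S>
    using that by (intro N.finite_measure_finite_Union[symmetric])
      (auto simp: disjoint_family_on_def V_def intro: finite_subset)
  have sum_cell: "(\<Sum>j\<in>T. measure M (cell k j)) = measure M (\<Union>j\<in>T. cell k j)" if "T \<subseteq> grid k" for T
    using that disjoint_cell by (intro M.finite_measure_finite_Union[symmetric])
      (auto simp: sM intro: finite_subset)
  obtain T where T: "T \<subseteq> grid k"
    and le: "(\<Sum>j\<in>T. measure M (cell k j)) + (\<Sum>S\<in>Pow (grid k). if S \<inter> T = {} then measure N (V S) else 0)
      \<le> p * (\<Sum>j\<in>grid k. measure M (cell k j)) + (\<Sum>S\<in>Pow (grid k). (1 - p) ^ card S * measure N (V S))"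
    using exists_hitting_subset[OF finite_grid[of k], of p "\<lambda>j. measure M (cell k j)" "\<lambda>S. measure N (V S)"] p
    by auto
  define R where "R = (\<Union>j\<in>T. cell k j)"
  have fin_T: "finite T" using finite_subset[OF T finite_grid] .
  have R_sets [measurable]: "R \<in> sets borel"
    using fin_T unfolding R_def by measurable
  have "p * (\<Sum>j\<in>grid k. measure M (cell k j)) \<le> p * measure M UNIV"
    unfolding sum_cell[OF order_refl] using p sM sets_eq_imp_space_eq[OF sM]
    by (intro mult_left_mono M.finite_measure_mono) auto
  moreover have "(\<Sum>S\<in>Pow (grid k). (1 - p) ^ card S * measure N (V S)) \<le>
      (\<Sum>S\<in>Pow (grid k). (1 - p) ^ s * measure N (V S))"
  proof (rule sum_mono)
    fix S
    show "(1 - p) ^ card S * measure N (V S) \<le> (1 - p) ^ s * measure N (V S)"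
    proof (cases "s \<le> card S")
      case True
      then show ?thesis using p by (intro mult_right_mono power_decreasing) auto
    next
      case False
      then have "V S = {}" by (auto simp: V_def)
      then show ?thesis by simp
    qed
  qed
  moreover have "\<dots> \<le> (1 - p) ^ s * measure N (space N)"
    unfolding sum_distrib_left[symmetric] sum_V[OF order_refl] using p
    by (intro mult_left_mono N.bounded_measure) auto
  ultimately have bound: "(\<Sum>j\<in>T. measure M (cell k j)) +
      (\<Sum>S\<in>Pow (grid k). if S \<inter> T = {} then measure N (V S) else 0) \<le> 2 * \<rho> / 3"
    using le s p(3) by linarith
  have miss: "(\<Sum>S\<in>Pow (grid k). if S \<inter> T = {} then measure N (V S) else 0) =
      measure N (\<Union>S\<in>{S\<in>Pow (grid k). S \<inter> T = {}}. V S)"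
    by (subst sum.inter_filter[symmetric], simp, rule sum_V, blast)
  show ?thesis
  proof
    show "R \<in> sets borel" by fact
    have "0 \<le> (\<Sum>S\<in>Pow (grid k). if S \<inter> T = {} then measure N (V S) else 0)"
      by (intro sum_nonneg) auto
    then show "measure M R \<le> \<rho>"
      using bound \<open>0 < \<rho>\<close> sum_cell[OF T] unfolding R_def by linarith
    let ?U = "\<Union>S\<in>{S\<in>Pow (grid k). S \<inter> T = {}}. V S"
    \<comment> \<open>If \<open>K y\<close> misses \<open>R\<close>, it charges no cell of
      \<open>T\<close>; so its pattern either is disjoint from \<open>T\<close> and counted in
      \<open>?U\<close>, or has fewer than \<open>s\<close> cells, which puts \<open>y\<close> in
      \<open>H k\<close>.\<close>
    have "{y \<in> space N. spread (K y) \<and> measure (K y) R = 0} \<subseteq> H k \<union> ?U"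
    proof
      fix y assume y: "y \<in> {y \<in> space N. spread (K y) \<and> measure (K y) R = 0}"
      then have "K y \<in> space (prob_algebra borel)"
        using measurable_space[OF K] by auto
      then interpret Ky: prob_space "K y"
        by (simp add: space_prob_algebra)
      have sK: "sets (K y) = sets borel"
        using \<open>K y \<in> space (prob_algebra borel)\<close> by (simp add: space_prob_algebra)
      have "charged (K y) k \<inter> T = {}"
      proof -
        have False if "j \<in> charged (K y) k" "j \<in> T" for j
        proof -
          have "measure (K y) (cell k j) \<le> measure (K y) R"
            using that sK by (intro Ky.finite_measure_mono) (auto simp: R_def)
          then show False
            using that y measure_nonneg[of "K y" "cell k j"] by (auto simp: charged_def)
        qed
        then show ?thesis by blast
      qed
      then have "y \<in> V (charged (K y) k) \<or> card (charged (K y) k) < s"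
        using y by (auto simp: V_def)
      then show "y \<in> H k \<union> ?U"
        using y \<open>charged (K y) k \<inter> T = {}\<close> charged_subset by (auto simp: H_def)
    qed
    moreover have "?U \<in> sets N"
      by (intro sets.finite_UN) auto
    ultimately have "measure N {y \<in> space N. spread (K y) \<and> measure (K y) R = 0} \<le> measure N (H k \<union> ?U)"
      by (intro N.finite_measure_mono) auto
    also have "\<dots> \<le> measure N (H k) + measure N ?U"
      using \<open>?U \<in> sets N\<close> by (intro measure_Un_le) auto
    also have "\<dots> \<le> \<rho>"
      using k bound miss sum_nonneg[of T "\<lambda>j. measure M (cell k j)"] by simp
    finally show "measure N {y \<in> space N. spread (K y) \<and> measure (K y) R = 0} \<le> \<rho>" .
  qed
qed

section \<open>Sufficient conditions for charging many cells\<close>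

text \<open>A cell with both endpoints in \<open>[a, b]\<close> has positive mass, being an
  increment of the cdf, and every fine grid has \<open>s\<close> such cells.\<close>

lemma spread_if_strict_mono_cdf:
  assumes "real_distribution \<kappa>" "a < b" and mono: "strict_mono_on {a..b} (cdf \<kappa>)"
  shows "spread \<kappa>"
  unfolding spread_def
proof
  fix s :: nat
  interpret real_distribution \<kappa> by fact
  obtain n0 :: nat where n0: "max ((s + 1) / (b - a)) (\<bar>a\<bar> + 1 + s) \<le> n0"
    using real_arch_simple by blast
  have "s \<le> card (charged \<kappa> n)" if "Suc n0 \<le> n" for n
  proof -
    obtain m where m: "n = Suc m" using \<open>Suc n0 \<le> n\<close> by (cases n) auto
    have n: "(s + 1) / (b - a) \<le> real n" "\<bar>a\<bar> + 1 + s \<le> real n" "0 < real n"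
      using n0 that by auto
    \<comment> \<open>These are the \<open>s\<close> cells that follow the one containing
      \<open>a\<close>.\<close>
    have "{\<lceil>a * n\<rceil> + 1..\<lceil>a * n\<rceil> + int s} \<subseteq> charged \<kappa> n"
    proof
      fix j assume j: "j \<in> {\<lceil>a * n\<rceil> + 1..\<lceil>a * n\<rceil> + int s}"
      have lo: "a * n \<le> real_of_int j - 1"
        using j by simp linarith
      have hi: "real_of_int j \<le> a * n + 1 + s"
        using j by simp linarith
      have "s + 1 \<le> (b - a) * n"
        using n \<open>a < b\<close> by (simp add: field_simps)
      then have "a \<le> (real_of_int j - 1) / n" "(real_of_int j - 1) / n < j / n" "j / n \<le> b"
        using lo hi n by (auto simp: field_simps)
      then have "cdf \<kappa> ((real_of_int j - 1) / n) < cdf \<kappa> (j / n)"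
        by (intro strict_mono_onD[OF mono]) auto
      then have "measure \<kappa> (cell n j) \<noteq> 0"
        using cdf_diff_eq[of "(real_of_int j - 1) / n" "j / n"] \<open>_ < j / n\<close>
        unfolding m cell_eq by simp
      moreover have "j \<in> grid n"
      proof -
        have "1 + real s \<le> (1 + real s) * n"
          using n mult_left_mono[of 1 n "1 + real s"] by simp
        then have "\<bar>a * n\<bar> + 1 + s \<le> (\<bar>a\<bar> + 1 + s) * n"
          by (simp add: abs_mult algebra_simps)
        also have "\<dots> \<le> real n * n"
          using n by (intro mult_right_mono) auto
        finally have "\<bar>real_of_int j\<bar> \<le> real n * n"
          using lo hi by linarith
        then have "\<bar>real_of_int j\<bar> \<le> real_of_int (int n ^ 2)"
          by (simp add: power2_eq_square)
        then show ?thesis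
          unfolding grid_def by (simp only: of_int_abs[symmetric] of_int_le_iff) auto
      qed
      ultimately show "j \<in> charged \<kappa> n"
        by (simp add: charged_def)
    qed
    then have "card {\<lceil>a * n\<rceil> + 1..\<lceil>a * n\<rceil> + int s} \<le> card (charged \<kappa> n)"
      by (rule card_mono[OF finite_subset[OF charged_subset finite_grid]])
    then show ?thesis by simp
  qed
  then show "\<forall>\<^sub>F k in sequentially. s \<le> card (charged \<kappa> k)"
    unfolding eventually_sequentially by blast
qed

text \<open>On a bounded interval the cdf of \<open>\<gamma>\<close> is uniformly continuous, so
  fine cells have \<open>\<gamma>\<close>-mass at most \<open>1 / (2 * (s + 1))\<close>. Collecting
  more than half of the mass takes more than \<open>s + 1\<close> of them, and cells that
  \<open>\<kappa>\<close> does not charge contribute nothing.\<close>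

lemma spread_if_diffuse_absolutely_continuous:
  assumes \<kappa>: "sets \<kappa> = sets borel"
    and "real_distribution \<gamma>" and atomless: "\<And>x. measure \<gamma> {x} = 0"
    and ac: "absolutely_continuous \<kappa> \<gamma>"
    and fin: "finite_measure \<kappa>"
  shows "spread \<kappa>"
  unfolding spread_def
proof
  fix s :: nat
  interpret \<kappa>: finite_measure \<kappa> by fact
  interpret real_distribution \<gamma> by fact
  have "(\<lambda>L. cdf \<gamma> (real L) - cdf \<gamma> (- real L)) \<longlonglongrightarrow> 1 - 0"
    by (intro tendsto_diff cdf_lim_infty_prob cdf_lim_neg_infty)
  then have "\<forall>\<^sub>F L in sequentially. 1 / 2 < cdf \<gamma> (real L) - cdf \<gamma> (- real L)"
    by (intro order_tendstoD) auto
  then obtain L where L: "1 / 2 < cdf \<gamma> (real L) - cdf \<gamma> (- real L)"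
    by (auto simp: eventually_sequentially)
  then have "L \<noteq> 0" by (intro notI) simp
  \<comment> \<open>The margin 1 leaves room for the left endpoint of the cell containing
    \<open>-L\<close>, which lies below \<open>-L\<close>.\<close>
  have "continuous_on {- (real L + 1)..real L + 1} (cdf \<gamma>)"
    using atomless by (intro continuous_at_imp_continuous_on) (auto simp: isCont_cdf)
  then have "uniformly_continuous_on {- (real L + 1)..real L + 1} (cdf \<gamma>)"
    by (rule compact_uniformly_continuous) simp
  moreover have "0 < 1 / real (2 * (s + 1))"
    by simp
  ultimately have "\<exists>d>0. \<forall>x\<in>{- (real L + 1)..real L + 1}. \<forall>y\<in>{- (real L + 1)..real L + 1}.
      dist y x < d \<longrightarrow> dist (cdf \<gamma> y) (cdf \<gamma> x) < 1 / real (2 * (s + 1))"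
    unfolding uniformly_continuous_on_def by blast
  then obtain d where "0 < d" and d: "\<And>x y. x \<in> {- (real L + 1)..real L + 1} \<Longrightarrow>
      y \<in> {- (real L + 1)..real L + 1} \<Longrightarrow> dist y x < d \<Longrightarrow>
      dist (cdf \<gamma> y) (cdf \<gamma> x) < 1 / real (2 * (s + 1))"
    by blast
  obtain n0 :: nat where n0: "max (real L + 1) (1 / d + 1) \<le> n0"
    using real_arch_simple by blast
  have "s \<le> card (charged \<kappa> n)" if "Suc n0 \<le> n" for n
  proof -
    obtain m where m: "n = Suc m" using \<open>Suc n0 \<le> n\<close> by (cases n) auto
    have n: "real L + 1 \<le> n" "1 / d < n" "0 < real n"
      using n0 that by auto
    then have "1 / n < d"
      using \<open>0 < d\<close> by (simp add: field_simps)
    let ?J = "{- int (n * L)..int (n * L)}"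
    have small: "measure \<gamma> (cell n j) \<le> 1 / (2 * (s + 1))" if "j \<in> ?J" for j
    proof -
      have "real_of_int (- int (n * L)) \<le> real_of_int j" "real_of_int j \<le> real_of_int (int (n * L))"
        using that by (simp_all only: of_int_le_iff atLeastAtMost_iff)
      then have "- (real n * L) \<le> j" "j \<le> real n * L"
        by simp_all
      then have "- (real L + 1) \<le> (real_of_int j - 1) / n" "(real_of_int j - 1) / n < j / n" "j / n \<le> real L"
        using n by (auto simp: field_simps)
      moreover have "dist (j / n) ((real_of_int j - 1) / n) < d"
        using \<open>1 / n < d\<close> n by (simp add: dist_real_def diff_divide_distrib)
      ultimately have "dist (cdf \<gamma> (j / n)) (cdf \<gamma> ((real_of_int j - 1) / n)) < 1 / (2 * (s + 1))"
        by (intro d) auto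
      then show ?thesis
        using cdf_diff_eq[of "(real_of_int j - 1) / n" "j / n"] \<open>_ < j / n\<close>
        unfolding m cell_eq by (simp add: dist_real_def)
    qed
    have null: "measure \<gamma> (cell n j) = 0" if "j \<in> ?J" "j \<notin> charged \<kappa> n" for j
    proof -
      \<comment> \<open>Since \<open>L \<le> n\<close>, all of \<open>?J\<close> lies in the grid,
        so absence from \<open>charged\<close> does mean zero mass.\<close>
      have "n * L \<le> n * n"
        using n by (intro mult_left_mono) auto
      then have "int (n * L) \<le> int (n * n)"
        by (simp only: of_nat_le_iff)
      also have "\<dots> = int n ^ 2"
        by (simp add: power2_eq_square)
      finally have "j \<in> grid n"
        using \<open>j \<in> ?J\<close> unfolding grid_def atLeastAtMost_iff by linarith
      then have "measure \<kappa> (cell n j) = 0"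
        using that by (auto simp: charged_def)
      then have "cell n j \<in> null_sets \<kappa>"
        using \<kappa> by (auto simp: null_sets_def \<kappa>.emeasure_eq_measure)
      then have "cell n j \<in> null_sets \<gamma>"
        using ac by (auto simp: absolutely_continuous_def)
      then show ?thesis by (simp add: measure_eq_0_null_sets)
    qed
    have "0 < real L" using \<open>L \<noteq> 0\<close> by simp
    have "1 / 2 < measure \<gamma> {- real L<..real L}"
      using L cdf_diff_eq[of "- real L" "real L"] \<open>0 < real L\<close> by simp
    also have "\<dots> \<le> measure \<gamma> (\<Union>j\<in>?J. cell n j)"
    proof (rule finite_measure_mono)
      show "{- real L<..real L} \<subseteq> (\<Union>j\<in>?J. cell n j)"
      proof
        fix x assume "x \<in> {- real L<..real L}"
        then have "real n * - real L \<le> real n * x" "real n * x \<le> real n * real L"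
          by (intro mult_left_mono; simp)+
        then have "real_of_int (- int (n * L)) - 1 < real n * x" "real n * x \<le> real_of_int (int (n * L))"
          by simp_all
        then have "- int (n * L) \<le> \<lceil>real n * x\<rceil>" "\<lceil>real n * x\<rceil> \<le> int (n * L)"
          by (simp_all only: le_ceiling_iff ceiling_le_iff)
        then show "x \<in> (\<Union>j\<in>?J. cell n j)"
          by (auto simp: cell_def)
      qed
    qed auto
    also have "\<dots> \<le> (\<Sum>j\<in>?J. measure \<gamma> (cell n j))"
      by (intro finite_measure_subadditive_finite) auto
    also have "\<dots> = (\<Sum>j\<in>?J \<inter> charged \<kappa> n. measure \<gamma> (cell n j))"
      using null by (intro sum.mono_neutral_right) auto
    also have "\<dots> \<le> (\<Sum>j\<in>?J \<inter> charged \<kappa> n. 1 / (2 * (s + 1)))"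
      using small by (intro sum_mono) auto
    also have "\<dots> = card (?J \<inter> charged \<kappa> n) / (2 * (s + 1))"
      by simp
    finally have "s + 1 < card (?J \<inter> charged \<kappa> n)"
      by (simp add: field_simps)
    also have "\<dots> \<le> card (charged \<kappa> n)"
      by (intro card_mono finite_subset[OF charged_subset]) auto
    finally show ?thesis by simp
  qed
  then show "\<forall>\<^sub>F k in sequentially. s \<le> card (charged \<kappa> k)"
    unfolding eventually_sequentially by blast
qed

subsection \<open>Disintegrations and the representation property\<close>

locale bidisintegration =
  fixes \<pi> :: "(real \<times> 'y::second_countable_topology) measure"
    and KX :: "real \<Rightarrow> 'y measure"
    and KY :: "'y \<Rightarrow> real measure"
  assumes prob_\<pi>: "prob_space \<pi>" and sets_\<pi>: "sets \<pi> = sets borel"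
    and disint_fst: "disintegration_fst \<pi> KX"
    and disint_snd: "disintegration_snd \<pi> KY"
begin

abbreviation "\<mu> \<equiv> marg_fst \<pi>"
abbreviation "\<nu> \<equiv> marg_snd \<pi>"
abbreviation "D \<equiv> dirac_set KY"

text \<open>Second countability of both factors makes the Borel and product sigma-algebras
  agree.\<close>

lemma sets_\<pi>_pair [measurable_cong]: "sets \<pi> = sets (borel \<Otimes>\<^sub>M borel)"
  unfolding sets_\<pi> borel_prod by (rule refl)

lemma space_\<pi> [simp]: "space \<pi> = UNIV"
  using sets_eq_imp_space_eq[OF sets_\<pi>] by simp

sublocale \<pi>: prob_space \<pi>
  by (rule prob_\<pi>)

sublocale \<mu>: prob_space \<mu>
  by (intro \<pi>.prob_space_distr) measurable

sublocale \<nu>: prob_space \<nu>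
  by (intro \<pi>.prob_space_distr) measurable

lemma KX_prob [measurable]: "KX \<in> borel \<rightarrow>\<^sub>M prob_algebra borel"
  using disint_fst by (simp add: disintegration_fst_def)

lemma KY_prob [measurable]: "KY \<in> borel \<rightarrow>\<^sub>M prob_algebra borel"
  using disint_snd by (simp add: disintegration_snd_def)

lemma KX_subprob [measurable]: "KX \<in> borel \<rightarrow>\<^sub>M subprob_algebra borel"
  by (rule measurable_prob_algebraD) (rule KX_prob)

lemma KY_subprob [measurable]: "KY \<in> borel \<rightarrow>\<^sub>M subprob_algebra borel"
  by (rule measurable_prob_algebraD) (rule KY_prob)

lemma prob_space_KX: "prob_space (KX x)" and sets_KX [simp, measurable_cong]: "sets (KX x) = sets borel"
  using measurable_space[OF KX_prob, of x] by (auto simp: space_prob_algebra)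

lemma prob_space_KY: "prob_space (KY y)" and sets_KY [simp, measurable_cong]: "sets (KY y) = sets borel"
  using measurable_space[OF KY_prob, of y] by (auto simp: space_prob_algebra)

lemma space_KX [simp]: "space (KX x) = UNIV" and space_KY [simp]: "space (KY y) = UNIV"
  using sets_eq_imp_space_eq[OF sets_KX] sets_eq_imp_space_eq[OF sets_KY] by simp_all

text \<open>By the disintegration formula the exceptional set is null exactly when almost all its
  sections are. Paired with \<open>AE_snd_iff\<close>, this moves almost sure relations between
  \<open>x\<close> and \<open>y\<close> from one kernel to the other.\<close>

lemma AE_fst_iff:
  assumes [measurable]: "Measurable.pred (borel \<Otimes>\<^sub>M borel) (\<lambda>(x, y). P x y)"
  shows "(AE z in \<pi>. P (fst z) (snd z)) \<longleftrightarrow> (AE x in \<mu>. AE y in KX x. P x y)"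
proof -
  have E: "{z. \<not> P (fst z) (snd z)} \<in> sets \<pi>"
  proof -
    have [measurable]: "Measurable.pred \<pi> (\<lambda>z. P (fst z) (snd z))"
      using assms by (simp add: split_beta' measurable_cong_sets[OF sets_\<pi>_pair refl])
    have "{z \<in> space \<pi>. \<not> P (fst z) (snd z)} \<in> sets \<pi>"
      by measurable
    then show ?thesis by simp
  qed
  have sec: "{y. \<not> P x y} \<in> sets borel" for x
    by measurable
  have "(SIGMA x:space borel. {y. \<not> P x y}) = {z \<in> space (borel \<Otimes>\<^sub>M borel). \<not> (case z of (x, y) \<Rightarrow> P x y)}"
    by (auto simp: space_pair_measure)
  also have "\<dots> \<in> sets (borel \<Otimes>\<^sub>M borel)"
    by measurable
  finally have [measurable]: "(\<lambda>x. emeasure (KX x) {y. \<not> P x y}) \<in> borel_measurable borel"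
    by (rule emeasure_measurable_subprob_algebra2) measurable
  have "(AE z in \<pi>. P (fst z) (snd z)) \<longleftrightarrow> emeasure \<pi> {z. \<not> P (fst z) (snd z)} = 0"
    using E by (subst AE_iff_measurable[OF _ refl]) auto
  also have "\<dots> \<longleftrightarrow> (\<integral>\<^sup>+x. emeasure (KX x) {y. \<not> P x y} \<partial>\<mu>) = 0"
    using disint_fst E by (simp add: disintegration_fst_def)
  also have "\<dots> \<longleftrightarrow> (AE x in \<mu>. emeasure (KX x) {y. \<not> P x y} = 0)"
    by (rule nn_integral_0_iff_AE) measurable
  also have "\<dots> \<longleftrightarrow> (AE x in \<mu>. AE y in KX x. P x y)"
    using sec by (subst AE_iff_measurable[OF _ refl]) auto
  finally show ?thesis .
qed

lemma AE_snd_iff: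
  assumes [measurable]: "Measurable.pred (borel \<Otimes>\<^sub>M borel) (\<lambda>(x, y). P x y)"
  shows "(AE z in \<pi>. P (fst z) (snd z)) \<longleftrightarrow> (AE y in \<nu>. AE x in KY y. P x y)"
proof -
  have E: "{z. \<not> P (fst z) (snd z)} \<in> sets \<pi>"
  proof -
    have [measurable]: "Measurable.pred \<pi> (\<lambda>z. P (fst z) (snd z))"
      using assms by (simp add: split_beta' measurable_cong_sets[OF sets_\<pi>_pair refl])
    have "{z \<in> space \<pi>. \<not> P (fst z) (snd z)} \<in> sets \<pi>"
      by measurable
    then show ?thesis by simp
  qed
  have sec: "{x. \<not> P x y} \<in> sets borel" for y
    by measurable
  have "(SIGMA y:space borel. {x. \<not> P x y}) = {z \<in> space (borel \<Otimes>\<^sub>M borel). \<not> P (snd z) (fst z)}"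
    by (auto simp: space_pair_measure)
  also have "\<dots> \<in> sets (borel \<Otimes>\<^sub>M borel)"
    using measurable_compose[OF measurable_pair_swap' assms]
    by (simp add: split_beta')
  finally have [measurable]: "(\<lambda>y. emeasure (KY y) {x. \<not> P x y}) \<in> borel_measurable borel"
    by (rule emeasure_measurable_subprob_algebra2) measurable
  have "(AE z in \<pi>. P (fst z) (snd z)) \<longleftrightarrow> emeasure \<pi> {z. \<not> P (fst z) (snd z)} = 0"
    using E by (subst AE_iff_measurable[OF _ refl]) auto
  also have "\<dots> \<longleftrightarrow> (\<integral>\<^sup>+y. emeasure (KY y) {x. \<not> P x y} \<partial>\<nu>) = 0"
    using disint_snd E by (simp add: disintegration_snd_def)
  also have "\<dots> \<longleftrightarrow> (AE y in \<nu>. emeasure (KY y) {x. \<not> P x y} = 0)"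
    by (rule nn_integral_0_iff_AE) measurable
  also have "\<dots> \<longleftrightarrow> (AE y in \<nu>. AE x in KY y. P x y)"
    using sec by (subst AE_iff_measurable[OF _ refl]) auto
  finally show ?thesis .
qed

text \<open>If \<open>KY y\<close> is a Dirac mass, this is its location; \<open>arctan\<close> keeps the integral meaningful for
  every \<open>y\<close>, which makes measurability immediate.\<close>

definition dirac_point :: "'y \<Rightarrow> real" where
  "dirac_point y = tan (\<integral>x. arctan x \<partial>KY y)"

lemma measurable_dirac_point [measurable]: "dirac_point \<in> borel_measurable borel"
proof -
  have [measurable]: "(\<lambda>y. \<integral>x. arctan x \<partial>KY y) \<in> borel_measurable borel"
    by (rule measurable_compose[OF KY_subprob]) measurable
  show ?thesis
    unfolding dirac_point_def tan_def by measurable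
qed

text \<open>The existential over locations becomes a test at one measurable point, which makes
  \<open>D\<close> Borel.\<close>

lemma dirac_set_iff: "y \<in> D \<longleftrightarrow> measure (KY y) {dirac_point y} = 1"
  and dirac_setI: "measure (KY y) {c} = 1 \<Longrightarrow> y \<in> D"
proof -
  interpret KY: prob_space "KY y" by (rule prob_space_KY)
  show I: "y \<in> D" if c: "measure (KY y) {c} = 1" for c
  proof -
    have "KY y = return borel c"
    proof (rule measure_eqI)
      fix A assume "A \<in> sets (KY y)"
      then have A: "A \<in> sets borel" by simp
      have ae: "AE x in KY y. x = c"
        using KY.AE_prob_1[OF c] by simp
      have "emeasure (KY y) A = emeasure (KY y) (if c \<in> A then UNIV else {})"
        using ae A by (intro emeasure_eq_AE) auto
      then show "emeasure (KY y) A = emeasure (return borel c) A"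
        using A KY.emeasure_space_1 by (simp add: indicator_def split: if_splits)
    qed simp
    then show ?thesis by (auto simp: dirac_set_def)
  qed
  show "y \<in> D \<longleftrightarrow> measure (KY y) {dirac_point y} = 1"
  proof
    assume "y \<in> D"
    then obtain c where c: "KY y = return borel c"
      by (auto simp: dirac_set_def)
    then have "dirac_point y = c"
      unfolding dirac_point_def c by (subst integral_return) (auto simp: tan_arctan)
    then show "measure (KY y) {dirac_point y} = 1"
      by (simp add: c measure_return)
  qed (rule I)
qed

lemma sets_dirac_set [measurable]: "D \<in> sets borel"
proof -
  \<comment> \<open>The graph of \<open>dirac_point\<close> is measurable, so the mass at this
    moving point depends measurably on \<open>y\<close>.\<close>
  have "(SIGMA y:space borel. {dirac_point y}) = {z \<in> space (borel \<Otimes>\<^sub>M borel). snd z = dirac_point (fst z)}"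
    by (auto simp: space_pair_measure)
  also have "\<dots> \<in> sets (borel \<Otimes>\<^sub>M borel)"
    by measurable
  finally have [measurable]: "(\<lambda>y. measure (KY y) {dirac_point y}) \<in> borel_measurable borel"
    by (rule measure_measurable_subprob_algebra2) measurable
  have "D = {y \<in> space borel. measure (KY y) {dirac_point y} = 1}"
    by (auto simp: dirac_set_iff)
  then show ?thesis
    by simp
qed

lemma measurable_measure_KX [measurable]:
  assumes [measurable]: "A \<in> sets borel"
  shows "(\<lambda>x. measure (KX x) A) \<in> borel_measurable borel"
  by (rule measurable_compose[OF KX_subprob]) measurable

text \<open>For \<open>y \<in> D\<close> all mass of \<open>KY y\<close> sits at
  \<open>dirac_point y\<close>; exchanging the kernels shows that on \<open>D\<close> almost surely
  \<open>y\<close> determines \<open>x\<close>.\<close>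

lemma AE_dirac_point: "AE x in \<mu>. AE y in KX x. y \<in> D \<longrightarrow> x = dirac_point y"
proof -
  have "AE x in KY y. y \<in> D \<longrightarrow> x = dirac_point y" for y
  proof (cases "y \<in> D")
    case True
    then show ?thesis
      using prob_space.AE_prob_1[OF prob_space_KY, of y "{dirac_point y}"] by (simp add: dirac_set_iff)
  qed simp
  moreover have "(AE z in \<pi>. snd z \<in> D \<longrightarrow> fst z = dirac_point (snd z)) \<longleftrightarrow>
      (AE x in \<mu>. AE y in KX x. y \<in> D \<longrightarrow> x = dirac_point y)"
    by (rule AE_fst_iff) measurable
  moreover have "(AE z in \<pi>. snd z \<in> D \<longrightarrow> fst z = dirac_point (snd z)) \<longleftrightarrow>
      (AE y in \<nu>. AE x in KY y. y \<in> D \<longrightarrow> x = dirac_point y)"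
    by (rule AE_snd_iff) measurable
  ultimately show ?thesis
    by simp
qed

text \<open>A \<open>\<nu>\<close>-null set has a \<open>\<pi>\<close>-null preimage under the
  projection, and almost all sections of that preimage are null.\<close>

lemma AE_KX_if_AE_snd:
  assumes "AE y in \<nu>. P y" and [measurable]: "Measurable.pred borel P"
  shows "AE x in \<mu>. AE y in KX x. P y"
proof -
  have "AE z in \<pi>. P (snd z)"
    using assms(1) by (subst (asm) AE_distr_iff) auto
  moreover have "(AE z in \<pi>. P (snd z)) \<longleftrightarrow> (AE x in \<mu>. AE y in KX x. P y)"
    by (rule AE_fst_iff) measurable
  ultimately show ?thesis
    by simp
qed

section \<open>From condition (D) to property (R+)\<close>

lemma prop_Rplus_if_cond_D:
  assumes "cond_D \<pi> KX KY"
  shows "prop_Rplus \<pi> KX"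
  unfolding prop_Rplus_def
proof (intro allI impI, elim conjE)
  fix f :: "real \<Rightarrow> real"
  assume f: "integrable \<mu> f" and nonneg: "AE x in \<mu>. 0 \<le> f x"
  have [measurable]: "f \<in> borel_measurable borel"
    using borel_measurable_integrable[OF f] by simp
  \<comment> \<open>Truncation makes \<open>g\<close> nonnegative everywhere, as \<open>f\<close> is
    so only almost everywhere; a zero denominator gives the value 0.\<close>
  define g where "g y = (if y \<in> D then max 0 (f (dirac_point y)) / measure (KX (dirac_point y)) D else 0)" for y
  have [measurable]: "g \<in> borel_measurable borel"
    unfolding g_def by measurable
  have "AE x in \<mu>. ennreal (f x) = (\<integral>\<^sup>+y. ennreal (g y) \<partial>KX x)"
    using AE_dirac_point nonneg assms[unfolded cond_D_def]
  proof eventually_elim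
    fix x assume x: "AE y in KX x. y \<in> D \<longrightarrow> x = dirac_point y" "0 \<le> f x" "0 < measure (KX x) D"
    interpret KX: prob_space "KX x" by (rule prob_space_KX)
    \<comment> \<open>Almost surely on \<open>D\<close> the point \<open>dirac_point y\<close>
      equals \<open>x\<close>, so \<open>g\<close> is constant there.\<close>
    have "(\<integral>\<^sup>+y. ennreal (g y) \<partial>KX x) = (\<integral>\<^sup>+y. ennreal (f x / measure (KX x) D) * indicator D y \<partial>KX x)"
      using x(1,2) by (intro nn_integral_cong_AE) (auto simp: g_def indicator_def)
    also have "\<dots> = ennreal (f x / measure (KX x) D) * emeasure (KX x) D"
      by (subst nn_integral_cmult_indicator) auto
    also have "\<dots> = ennreal (f x)"
      using x(2,3) by (simp add: KX.emeasure_eq_measure flip: ennreal_mult')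
    finally show "ennreal (f x) = (\<integral>\<^sup>+y. ennreal (g y) \<partial>KX x)" ..
  qed
  then show "\<exists>g::'y \<Rightarrow> real. g \<in> borel_measurable borel \<and> (\<forall>y. 0 \<le> g y) \<and>
      (AE x in \<mu>. ennreal (f x) = (\<integral>\<^sup>+y. ennreal (g y) \<partial>KX x))"
    by (intro exI[of _ g]) (auto simp: g_def)
qed

section \<open>Consequences of representing an indicator\<close>

text \<open>Take for \<open>B\<close> the positivity set of a representing \<open>g\<close>. For
  \<open>x\<close> outside \<open>A\<close> the integral is 0, so \<open>KX x\<close> does not
  charge \<open>B\<close>; exchanging the kernels gives the claim on \<open>KY\<close>. For
  \<open>x\<close> in \<open>A\<close> the integral is 1, so \<open>B\<close> is charged.\<close>

lemma prop_Rplus_indicator: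
  assumes R: "prop_Rplus \<pi> KX" and A[measurable]: "A \<in> sets borel"
  obtains B where "B \<in> sets borel" "AE y in \<nu>. y \<in> B \<longrightarrow> measure (KY y) A = 1"
    "AE x in \<mu>. x \<in> A \<longrightarrow> 0 < measure (KX x) B"
proof -
  have "integrable \<mu> (indicator A :: real \<Rightarrow> real)"
    by (intro \<mu>.integrable_const_bound[where B=1]) (auto simp: indicator_def)
  then have "\<exists>g::'y \<Rightarrow> real. g \<in> borel_measurable borel \<and> (\<forall>y. 0 \<le> g y) \<and>
      (AE x in \<mu>. ennreal (indicator A x) = (\<integral>\<^sup>+y. ennreal (g y) \<partial>KX x))"
    using R unfolding prop_Rplus_def by simp
  then obtain g :: "'y \<Rightarrow> real" where [measurable]: "g \<in> borel_measurable borel"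
    and nonneg: "\<And>y. 0 \<le> g y"
    and g: "AE x in \<mu>. ennreal (indicator A x) = (\<integral>\<^sup>+y. ennreal (g y) \<partial>KX x)"
    by blast
  define B where "B = {y. 0 < g y}"
  have B[measurable]: "B \<in> sets borel"
    unfolding B_def by measurable
  have zero: "(\<integral>\<^sup>+y. ennreal (g y) \<partial>KX x) = 0 \<longleftrightarrow> (AE y in KX x. y \<notin> B)" for x
    using nonneg by (subst nn_integral_0_iff_AE) (auto simp: B_def ennreal_eq_0_iff not_less)
  show ?thesis
  proof
    have "AE x in \<mu>. AE y in KX x. y \<in> B \<longrightarrow> x \<in> A"
      using g
    proof eventually_elim
      fix x assume "ennreal (indicator A x) = (\<integral>\<^sup>+y. ennreal (g y) \<partial>KX x)"
      then show "AE y in KX x. y \<in> B \<longrightarrow> x \<in> A"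
        using zero[of x] by (cases "x \<in> A") auto
    qed
    moreover have "(AE z in \<pi>. snd z \<in> B \<longrightarrow> fst z \<in> A) \<longleftrightarrow> (AE x in \<mu>. AE y in KX x. y \<in> B \<longrightarrow> x \<in> A)"
      by (rule AE_fst_iff) measurable
    moreover have "(AE z in \<pi>. snd z \<in> B \<longrightarrow> fst z \<in> A) \<longleftrightarrow> (AE y in \<nu>. AE x in KY y. y \<in> B \<longrightarrow> x \<in> A)"
      by (rule AE_snd_iff) measurable
    ultimately have "AE y in \<nu>. AE x in KY y. y \<in> B \<longrightarrow> x \<in> A"
      by simp
    then show "AE y in \<nu>. y \<in> B \<longrightarrow> measure (KY y) A = 1"
      by eventually_elim (auto simp: prob_space.prob_eq_1[OF prob_space_KY])
    show "AE x in \<mu>. x \<in> A \<longrightarrow> 0 < measure (KX x) B"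
      using g
    proof eventually_elim
      fix x assume x: "ennreal (indicator A x) = (\<integral>\<^sup>+y. ennreal (g y) \<partial>KX x)"
      show "x \<in> A \<longrightarrow> 0 < measure (KX x) B"
      proof (intro impI, rule ccontr)
        assume "x \<in> A" "\<not> 0 < measure (KX x) B"
        then have "measure (KX x) B = 0"
          using measure_nonneg[of "KX x" B] by linarith
        then have "AE y in KX x. y \<notin> B"
          using prob_space.prob_eq_0[OF prob_space_KX, of B x] by simp
        then show False
          using x zero[of x] \<open>x \<in> A\<close> by simp
      qed
    qed
  qed fact
qed

text \<open>The set \<open>B\<close> obtained for \<open>{x}\<close> lies in \<open>D\<close> up to
  a null set, since a unit mass at one point is a Dirac mass.\<close>

lemma prop_Rplus_atom:
  assumes "prop_Rplus \<pi> KX" and atom: "measure \<mu> {x} \<noteq> 0"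
  shows "0 < measure (KX x) D"
proof -
  obtain B where [measurable]: "B \<in> sets borel" and B: "AE y in \<nu>. y \<in> B \<longrightarrow> measure (KY y) {x} = 1"
    "AE x' in \<mu>. x' \<in> {x} \<longrightarrow> 0 < measure (KX x') B"
    using prop_Rplus_indicator[OF assms(1), of "{x}"] by auto
  have "AE y in \<nu>. y \<in> B \<longrightarrow> y \<in> D"
    using B(1) by eventually_elim (auto intro: dirac_setI)
  then have "AE x' in \<mu>. AE y in KX x'. y \<in> B \<longrightarrow> y \<in> D"
    by (rule AE_KX_if_AE_snd) measurable
  with B(2) have "AE x' in \<mu>. x' \<in> {x} \<longrightarrow> 0 < measure (KX x') D"
  proof eventually_elim
    fix x' assume x': "x' \<in> {x} \<longrightarrow> 0 < measure (KX x') B" "AE y in KX x'. y \<in> B \<longrightarrow> y \<in> D"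
    interpret KX: prob_space "KX x'" by (rule prob_space_KX)
    have "measure (KX x') B \<le> measure (KX x') D"
      using x'(2) by (intro KX.finite_measure_mono_AE) auto
    then show "x' \<in> {x} \<longrightarrow> 0 < measure (KX x') D"
      using x'(1) by auto
  qed
  \<comment> \<open>An atom cannot be exceptional, so the almost sure statement holds at
    \<open>x\<close> itself.\<close>
  then have "AE x' in \<mu>. x' \<noteq> x" if "\<not> 0 < measure (KX x) D"
    using that by (elim AE_mp) auto
  moreover have "\<not> (AE x' in \<mu>. x' \<noteq> x)"
    using atom \<mu>.prob_eq_0[of "{x}"] by auto
  ultimately show ?thesis by blast
qed

text \<open>With summable errors in \<open>spread_removal\<close> the union of the sets stays small,
  while a measure that misses the union misses every \<open>R n\<close>, an event of mass at most
  \<open>\<rho> n\<close> for each \<open>n\<close>.\<close>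

lemma small_set_charged_if_spread:
  assumes "0 < \<delta>"
  obtains R where "R \<in> sets borel" "measure \<mu> R < \<delta>"
    "AE y in \<nu>. spread (KY y) \<longrightarrow> measure (KY y) R \<noteq> 0"
proof -
  \<comment> \<open>The sum is \<open>\<delta> / 2\<close>, so the final bound is strict.\<close>
  define \<rho> where "\<rho> n = \<delta> / 2 * (1 / 2) ^ Suc n" for n
  have pos: "0 < \<rho> n" for n
    using assms by (simp add: \<rho>_def)
  have "\<exists>R. R \<in> sets borel \<and> measure \<mu> R \<le> \<rho> n \<and>
      measure \<nu> {y. spread (KY y) \<and> measure (KY y) R = 0} \<le> \<rho> n" for n
  proof -
    obtain R where "R \<in> sets borel" "measure \<mu> R \<le> \<rho> n"
      "measure \<nu> {y \<in> space \<nu>. spread (KY y) \<and> measure (KY y) R = 0} \<le> \<rho> n"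
      by (rule spread_removal[of \<nu> KY \<mu> "\<rho> n"])
        (auto simp: pos \<nu>.finite_measure_axioms \<mu>.finite_measure_axioms)
    then show ?thesis by auto
  qed
  then have "\<exists>R. \<forall>n. R n \<in> sets borel \<and> measure \<mu> (R n) \<le> \<rho> n \<and>
      measure \<nu> {y. spread (KY y) \<and> measure (KY y) (R n) = 0} \<le> \<rho> n"
    by (intro choice allI)
  then obtain R where R[measurable]: "\<And>n. R n \<in> sets borel" and small: "\<And>n. measure \<mu> (R n) \<le> \<rho> n"
    and miss: "\<And>n. measure \<nu> {y. spread (KY y) \<and> measure (KY y) (R n) = 0} \<le> \<rho> n"
    by blast
  have \<rho>_sums: "\<rho> sums (\<delta> / 2 * 1)"
    unfolding \<rho>_def by (intro sums_mult power_half_series)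
  have summable: "summable (\<lambda>n. measure \<mu> (R n))"
    by (rule summable_comparison_test'[OF sums_summable[OF \<rho>_sums], of 0]) (simp add: small)
  show ?thesis
  proof
    show "(\<Union>n. R n) \<in> sets borel" by measurable
    have "measure \<mu> (\<Union>n. R n) \<le> (\<Sum>n. measure \<mu> (R n))"
      using summable by (intro \<mu>.finite_measure_subadditive_countably) auto
    also have "\<dots> \<le> (\<Sum>n. \<rho> n)"
      using summable small sums_summable[OF \<rho>_sums] by (intro suminf_le) auto
    also have "\<dots> < \<delta>"
      using sums_unique[OF \<rho>_sums] assms by simp
    finally show "measure \<mu> (\<Union>n. R n) < \<delta>" .
    note measurable_spread[measurable]
    have [measurable]: "(\<lambda>y. measure (KY y) A) \<in> borel_measurable borel" if [measurable]: "A \<in> sets borel" for A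
      by (rule measurable_compose[OF KY_subprob]) measurable
    let ?M = "{y. spread (KY y) \<and> measure (KY y) (\<Union>n. R n) = 0}"
    have "?M = {y \<in> space borel. spread (KY y) \<and> measure (KY y) (\<Union>n. R n) = 0}"
      by simp
    also have "\<dots> \<in> sets borel"
      by measurable
    finally have [measurable]: "?M \<in> sets borel" .
    have "measure \<nu> ?M \<le> \<rho> n" for n
    proof -
      have [measurable]: "{y. spread (KY y) \<and> measure (KY y) (R n) = 0} \<in> sets borel"
      proof -
        have "{y \<in> space borel. spread (KY y) \<and> measure (KY y) (R n) = 0} \<in> sets borel"
          by measurable
        then show ?thesis by simp
      qed
      have "measure (KY y) (R n) \<le> measure (KY y) (\<Union>n. R n)" for y
      proof -
        interpret KY: prob_space "KY y" by (rule prob_space_KY)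
        show ?thesis by (intro KY.finite_measure_mono) auto
      qed
      then have "measure (KY y) (\<Union>n. R n) = 0 \<Longrightarrow> measure (KY y) (R n) = 0" for y
        by (metis measure_nonneg order_antisym)
      then have "measure \<nu> ?M \<le> measure \<nu> {y. spread (KY y) \<and> measure (KY y) (R n) = 0}"
        by (intro \<nu>.finite_measure_mono) auto
      also note miss
      finally show ?thesis .
    qed
    moreover have "\<rho> \<longlonglongrightarrow> 0"
      using \<rho>_sums by (intro summable_LIMSEQ_zero sums_summable)
    ultimately have "measure \<nu> ?M \<le> 0"
      by (intro LIMSEQ_le_const) auto
    then have "measure \<nu> ?M = 0"
      using measure_nonneg[of \<nu> ?M] by linarith
    then have "AE y in \<nu>. y \<notin> ?M"
      using \<nu>.prob_eq_0[of ?M] by auto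
    then show "AE y in \<nu>. spread (KY y) \<longrightarrow> measure (KY y) (\<Union>n. R n) \<noteq> 0"
      by eventually_elim auto
  qed
qed

text \<open>Otherwise remove from \<open>G\<close> a set \<open>R\<close> of smaller mass that
  almost all spread measures charge. For almost all \<open>y\<close>, if \<open>KY y\<close> is
  concentrated on \<open>G - R\<close>, it misses \<open>R\<close>, so it is not spread and
  \<open>y \<in> D\<close>. Thus the set \<open>B\<close> for \<open>G - R\<close> lies almost
  surely in \<open>D\<close>, which \<open>KX x\<close> does not charge for
  \<open>x \<in> G\<close>; so \<open>G - R\<close> is null.\<close>

lemma prop_Rplus_null:
  assumes Rplus: "prop_Rplus \<pi> KX" and G[measurable]: "G \<in> sets borel"
    and no_D: "\<And>x. x \<in> G \<Longrightarrow> measure (KX x) D = 0"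
    and spread: "AE y in \<nu>. measure (KY y) G = 1 \<and> y \<notin> D \<longrightarrow> spread (KY y)"
  shows "measure \<mu> G = 0"
proof (rule ccontr)
  assume "measure \<mu> G \<noteq> 0"
  then have "0 < measure \<mu> G"
    using measure_nonneg[of \<mu> G] by linarith
  then obtain R where R[measurable]: "R \<in> sets borel" and small: "measure \<mu> R < measure \<mu> G"
    and hit: "AE y in \<nu>. spread (KY y) \<longrightarrow> measure (KY y) R \<noteq> 0"
    by (rule small_set_charged_if_spread)
  obtain B where B[measurable]: "B \<in> sets borel"
    and BY: "AE y in \<nu>. y \<in> B \<longrightarrow> measure (KY y) (G - R) = 1"
    and BX: "AE x in \<mu>. x \<in> G - R \<longrightarrow> 0 < measure (KX x) B"
    using prop_Rplus_indicator[OF Rplus, of "G - R"] by auto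
  have "AE y in \<nu>. y \<in> B \<longrightarrow> y \<in> D"
    using BY hit spread
  proof eventually_elim
    fix y
    assume *: "y \<in> B \<longrightarrow> measure (KY y) (G - R) = 1" "spread (KY y) \<longrightarrow> measure (KY y) R \<noteq> 0"
      "measure (KY y) G = 1 \<and> y \<notin> D \<longrightarrow> spread (KY y)"
    interpret KY: prob_space "KY y" by (rule prob_space_KY)
    show "y \<in> B \<longrightarrow> y \<in> D"
    proof
      assume "y \<in> B"
      then have 1: "measure (KY y) (G - R) = 1" using * by simp
      moreover have "measure (KY y) (G - R) \<le> measure (KY y) G"
        by (intro KY.finite_measure_mono) auto
      ultimately have "measure (KY y) G = 1"
        using KY.prob_le_1[of G] by linarith
      moreover have "measure (KY y) (G - R) + measure (KY y) R = measure (KY y) ((G - R) \<union> R)"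
        by (intro KY.finite_measure_Union[symmetric]) auto
      then have "measure (KY y) R = 0"
        using 1 KY.prob_le_1[of "(G - R) \<union> R"] measure_nonneg[of "KY y" R] by linarith
      ultimately show "y \<in> D" using * by auto
    qed
  qed
  then have "AE x in \<mu>. AE y in KX x. y \<in> B \<longrightarrow> y \<in> D"
    by (rule AE_KX_if_AE_snd) measurable
  with BX have "AE x in \<mu>. x \<notin> G - R"
  proof eventually_elim
    fix x assume x: "x \<in> G - R \<longrightarrow> 0 < measure (KX x) B" "AE y in KX x. y \<in> B \<longrightarrow> y \<in> D"
    interpret KX: prob_space "KX x" by (rule prob_space_KX)
    have "measure (KX x) B \<le> measure (KX x) D"
      using x(2) by (intro KX.finite_measure_mono_AE) auto
    then show "x \<notin> G - R"
      using x(1) no_D by force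
  qed
  then have "measure \<mu> (G - R) = 0"
    using \<mu>.prob_eq_0[of "G - R"] by auto
  moreover have "measure \<mu> G \<le> measure \<mu> ((G - R) \<union> R)"
    by (intro \<mu>.finite_measure_mono) auto
  moreover have "\<dots> \<le> measure \<mu> (G - R) + measure \<mu> R"
    by (intro measure_Un_le) auto
  ultimately show False using small by linarith
qed

lemma sets_C_set [measurable]: "C_set \<pi> KX KY \<in> sets borel"
proof -
  \<comment> \<open>Measurability of the diagonal, used with the constant kernel
    \<open>\<mu>\<close>, makes the point mass measurable in \<open>x\<close>.\<close>
  have "(SIGMA x:space borel. {x}) = {z \<in> space (borel \<Otimes>\<^sub>M borel). snd z = (fst z :: real)}"
    by (auto simp: space_pair_measure)
  also have "\<dots> \<in> sets (borel \<Otimes>\<^sub>M borel)"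
    by measurable
  finally have [measurable]: "(\<lambda>x. measure \<mu> {x}) \<in> borel_measurable borel"
    by (rule measure_measurable_subprob_algebra2)
      (auto simp: space_subprob_algebra \<mu>.subprob_space_axioms)
  have "C_set \<pi> KX KY = {x \<in> space borel. measure \<mu> {x} + measure (KX x) D = 0}"
    by (simp add: C_set_def)
  also have "\<dots> \<in> sets borel"
    by measurable
  finally show ?thesis .
qed

lemma C_set_iff: "x \<in> C_set \<pi> KX KY \<longleftrightarrow> measure \<mu> {x} = 0 \<and> measure (KX x) D = 0"
  by (simp add: C_set_def add_nonneg_eq_0_iff)

end

section \<open>Localisation to short intervals and the equivalence\<close>

text \<open>The cdf is 0 to the left of the interval and 1 to the right, so alternative (iii) fails
  when the interval avoids \<open>X\<close>.\<close>

lemma cdf_not_in_open_unit: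
  assumes "prob_space \<kappa>" "sets \<kappa> = sets borel" "measure \<kappa> {q<..<r} = 1" "x \<notin> {q<..<r}"
  shows "cdf \<kappa> x \<notin> {0<..<1}"
proof -
  interpret prob_space \<kappa> by fact
  note assms(2)[simp]
  show ?thesis
  proof (cases "x \<le> q")
    case True
    then have "measure \<kappa> {..x} + measure \<kappa> {q<..<r} = measure \<kappa> ({..x} \<union> {q<..<r})"
      by (intro finite_measure_Union[symmetric]) auto
    then show ?thesis
      using assms(3) prob_le_1[of "{..x} \<union> {q<..<r}"] unfolding cdf_def greaterThanLessThan_iff by linarith
  next
    case False
    then have "measure \<kappa> {q<..<r} \<le> measure \<kappa> {..x}"
      using assms(4) by (intro finite_measure_mono) auto
    then show ?thesis
      using assms(3) by (simp add: cdf_def)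
  qed
qed

text \<open>Points off the closure have a neighbourhood free of \<open>X\<close>, and rational
  endpoints keep the family countable. The length bound serves membership in
  \<open>eps_set\<close>.\<close>

lemma countable_rational_cover:
  fixes X :: "real set"
  assumes "0 < \<epsilon>"
  defines "Q \<equiv> {(q, r). q \<in> \<rat> \<and> r \<in> \<rat> \<and> r \<le> q + \<epsilon> \<and> {q<..<r} \<inter> X = {}}"
  shows "countable Q" and "- closure X \<subseteq> (\<Union>(q, r)\<in>Q. {q<..<r})"
proof -
  have "Q \<subseteq> \<rat> \<times> \<rat>" by (auto simp: Q_def)
  then show "countable Q"
    by (rule countable_subset) (intro countable_SIGMA countable_rat)
  show "- closure X \<subseteq> (\<Union>(q, r)\<in>Q. {q<..<r})"
  proof
    fix x assume "x \<in> - closure X"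
    then obtain e where "0 < e" "ball x e \<subseteq> - closure X"
      by (metis open_Compl closed_closure open_contains_ball)
    then have ball: "z \<notin> X" if "\<bar>z - x\<bar> < e" for z
      using that closure_subset[of X] by (auto simp: subset_iff dist_real_def abs_minus_commute)
    define d where "d = min e (\<epsilon> / 2)"
    have "0 < d" "d \<le> e" "2 * d \<le> \<epsilon>" using \<open>0 < e\<close> assms(1) by (auto simp: d_def)
    obtain q r where "q \<in> \<rat>" "x - d < q" "q < x" "r \<in> \<rat>" "x < r" "r < x + d"
      using Rats_dense_in_real[of "x - d" x] Rats_dense_in_real[of x "x + d"] \<open>0 < d\<close> by auto
    moreover have "z \<notin> X" if "q < z" "z < r" for z
      using that \<open>x - d < q\<close> \<open>r < x + d\<close> \<open>d \<le> e\<close> by (intro ball) linarith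
    ultimately have "(q, r) \<in> Q"
      using \<open>2 * d \<le> \<epsilon>\<close> by (auto simp: Q_def)
    then show "x \<in> (\<Union>(q, r)\<in>Q. {q<..<r})"
      using \<open>q < x\<close> \<open>x < r\<close> by force
  qed
qed

theorem corollary2p10:
  fixes \<pi> :: "(real \<times> 'y::{banach, second_countable_topology}) measure"
    and KX :: "real \<Rightarrow> 'y measure"
    and KY :: "'y \<Rightarrow> real measure"
    and \<epsilon> :: real
    and \<eta> :: "real measure"
    and X :: "real set"
  assumes "prob_space \<pi>" and "sets \<pi> = sets borel"
    and "disintegration_fst \<pi> KX"
    and "disintegration_snd \<pi> KY"
    and "\<epsilon> > 0"
    and "prob_space \<eta>" and "sets \<eta> = sets borel" and "diffuse \<eta>"
    and "countable (closure X)"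
    and "AE y in marg_snd \<pi>.
           y \<in> eps_set KY \<epsilon> \<inter> - dirac_set KY \<and> measure (KY y) (C_set \<pi> KX KY) = 1 \<longrightarrow>
             (\<exists>a b. a < b \<and> strict_mono_on {a..b} (cdf (KY y))) \<or>
             (\<exists>\<gamma>. prob_space \<gamma> \<and> sets \<gamma> = sets borel \<and>
                  absolutely_continuous (KY y) \<gamma> \<and> absolutely_continuous \<eta> \<gamma>) \<or>
             (\<exists>x\<in>X. cdf (KY y) x \<in> {0<..<1})"
  shows "cond_D \<pi> KX KY \<longleftrightarrow> prop_Rplus \<pi> KX"
proof
  interpret bidisintegration \<pi> KX KY
    by (rule bidisintegration.intro) fact+
  show "cond_D \<pi> KX KY \<Longrightarrow> prop_Rplus \<pi> KX"
    by (rule prop_Rplus_if_cond_D)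
  assume Rplus: "prop_Rplus \<pi> KX"
  let ?C = "C_set \<pi> KX KY"
  define Q where "Q = {(q, r). q \<in> \<rat> \<and> r \<in> \<rat> \<and> r \<le> q + \<epsilon> \<and> {q<..<r} \<inter> X = {}}"
  have null: "measure \<mu> (?C \<inter> {q<..<r}) = 0" if "(q, r) \<in> Q" for q r
  proof (rule prop_Rplus_null[OF Rplus])
    show "AE y in \<nu>. measure (KY y) (?C \<inter> {q<..<r}) = 1 \<and> y \<notin> D \<longrightarrow> spread (KY y)"
      using assms(10)
    proof eventually_elim
      fix y
      assume cases: "y \<in> eps_set KY \<epsilon> \<inter> - D \<and> measure (KY y) ?C = 1 \<longrightarrow>
             (\<exists>a b. a < b \<and> strict_mono_on {a..b} (cdf (KY y))) \<or>
             (\<exists>\<gamma>. prob_space \<gamma> \<and> sets \<gamma> = sets borel \<and>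
                  absolutely_continuous (KY y) \<gamma> \<and> absolutely_continuous \<eta> \<gamma>) \<or>
             (\<exists>x\<in>X. cdf (KY y) x \<in> {0<..<1})"
      interpret KY: prob_space "KY y" by (rule prob_space_KY)
      have real: "real_distribution \<kappa>" if "prob_space \<kappa>" "sets \<kappa> = sets borel" for \<kappa> :: "real measure"
        using that by (simp add: real_distribution_def real_distribution_axioms_def)
      show "measure (KY y) (?C \<inter> {q<..<r}) = 1 \<and> y \<notin> D \<longrightarrow> spread (KY y)"
      proof (intro impI, elim conjE)
        assume 1: "measure (KY y) (?C \<inter> {q<..<r}) = 1" and "y \<notin> D"
        have full: "measure (KY y) A = 1" if "?C \<inter> {q<..<r} \<subseteq> A" "A \<in> sets borel" for A
          using KY.finite_measure_mono[of "?C \<inter> {q<..<r}" A] KY.prob_le_1[of A] that 1 by simp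
        \<comment> \<open>As \<open>{q<..<r}\<close> is contained in
          \<open>{q<..q + \<epsilon>}\<close>, the point \<open>q\<close> is the witness for
          \<open>eps_set\<close>.\<close>
        have "measure (KY y) {q<..q + \<epsilon>} = 1" "measure (KY y) ?C = 1" "measure (KY y) {q<..<r} = 1"
          using \<open>(q, r) \<in> Q\<close> by (auto intro!: full simp: Q_def)
        then consider a b where "a < b" "strict_mono_on {a..b} (cdf (KY y))"
          | \<gamma> where "prob_space \<gamma>" "sets \<gamma> = sets borel"
            "absolutely_continuous (KY y) \<gamma>" "absolutely_continuous \<eta> \<gamma>"
          | x where "x \<in> X" "cdf (KY y) x \<in> {0<..<1}"
          using cases \<open>y \<notin> D\<close> by (auto simp: eps_set_def)
        then show "spread (KY y)"
        proof cases
          case 1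
          then show ?thesis
            by (intro spread_if_strict_mono_cdf real prob_space_KY) auto
        next
          case 2
          \<comment> \<open>\<open>absolutely_continuous \<eta> \<gamma>\<close> says that
            \<open>\<eta>\<close>-null sets are \<open>\<gamma>\<close>-null, so
            \<open>\<gamma>\<close> inherits diffuseness.\<close>
          have "measure \<gamma> {x} = 0" for x
          proof -
            interpret \<eta>: prob_space \<eta> by fact
            have "{x} \<in> null_sets \<eta>"
              using assms(7,8) by (auto simp: null_sets_def diffuse_def \<eta>.emeasure_eq_measure)
            then have "{x} \<in> null_sets \<gamma>"
              using 2 by (auto simp: absolutely_continuous_def)
            then show ?thesis by (simp add: measure_eq_0_null_sets)
          qed
          then show ?thesis
            using 2 by (intro spread_if_diffuse_absolutely_continuous[of "KY y" \<gamma>] real)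
              (auto simp: KY.finite_measure_axioms)
        next
          case 3
          moreover have "x \<notin> {q<..<r}"
            using 3 \<open>(q, r) \<in> Q\<close> by (auto simp: Q_def)
          ultimately show ?thesis
            using cdf_not_in_open_unit[OF prob_space_KY sets_KY \<open>measure (KY y) {q<..<r} = 1\<close>] by blast
        qed
      qed
    qed
  qed (auto simp: C_set_iff)
  have "AE x in \<mu>. \<forall>p\<in>Q. x \<notin> ?C \<inter> {fst p<..<snd p}"
    using countable_rational_cover(1)[OF \<open>\<epsilon> > 0\<close>, of X] null \<mu>.prob_eq_0[of "?C \<inter> {_<..<_}"]
    by (subst AE_ball_countable) (auto simp flip: Q_def)
  \<comment> \<open>Points of \<open>?C\<close> are not atoms of \<open>\<mu>\<close>, so countably
    many of them form a null set.\<close>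
  moreover have "AE x in \<mu>. \<forall>c\<in>closure X. \<not> (x = c \<and> c \<in> ?C)"
  proof (subst AE_ball_countable[OF \<open>countable (closure X)\<close>], intro ballI)
    fix c
    show "AE x in \<mu>. \<not> (x = c \<and> c \<in> ?C)"
    proof (cases "c \<in> ?C")
      case True
      then show ?thesis
        using \<mu>.prob_eq_0[of "{c}"] by (auto simp: C_set_iff)
    qed simp
  qed
  ultimately have "AE x in \<mu>. x \<notin> ?C"
  proof eventually_elim
    fix x assume x: "\<forall>p\<in>Q. x \<notin> ?C \<inter> {fst p<..<snd p}" "\<forall>c\<in>closure X. \<not> (x = c \<and> c \<in> ?C)"
    show "x \<notin> ?C"
    proof (cases "x \<in> closure X")
      case False
      then obtain p where "p \<in> Q" "x \<in> {fst p<..<snd p}"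
        using countable_rational_cover(2)[OF \<open>\<epsilon> > 0\<close>, of X] unfolding Q_def by (auto simp: subset_iff)
      then show ?thesis using x(1) by auto
    qed (use x(2) in auto)
  qed
  then show "cond_D \<pi> KX KY"
    unfolding cond_D_def
  proof eventually_elim
    fix x assume "x \<notin> ?C"
    \<comment> \<open>Off \<open>?C\<close>, either \<open>KX x\<close> already charges
      \<open>D\<close>, or \<open>x\<close> is an atom of \<open>\<mu>\<close> and
      \<open>prop_Rplus_atom\<close> applies.\<close>
    then show "0 < measure (KX x) D"
      using prop_Rplus_atom[OF Rplus, of x] by (auto simp: C_set_iff zero_less_measure_iff)
  qed
qed

end
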